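(* Let $\mathcal{H}$ be a complex Hilbert space, $A\in\mathcal{B}(\mathcal{H})$ a positive operator, and $T,S\in\mathcal{B}_{A^{1/2}}(\mathcal{H})$. Then $$r_A(T+S)\leq\frac12\left(\omega_A(T)+\omega_A(S)+\sqrt{\left[\omega_A(T)-\omega_A(S)\right]^2+4\mu(T,S)}\right),$$ where $\mu(T,S)=\min\{\|TS\|_A,\|ST\|_A\}$.
   Context: $\mathcal{B}(\mathcal{H})$ is the algebra of bounded linear operators on the complex Hilbert space $(\mathcal{H},\langle\cdot\mid\cdot\rangle)$. For positive $A$, put $\langle x\mid y\rangle_A=\langle Ax\mid y\rangle$ and $\|x\|_A=\langle x\mid x\rangle_A^{1/2}=\|A^{1/2}x\|$. $\mathcal{B}_{A^{1/2}}(\mathcal{H})$ is the set of $T\in\mathcal{B}(\mathcal{H})$ for which there is $\lambda>0$ with $\|Tx\|_A\le\lambda\|x\|_A$ for all $x\in\mathcal{H}$ ($A$-bounded operators). For such $T$, $\|T\|_A=\sup\{\|Tx\|_A: x\in\mathcal{H},\ \|x\|_A=1\}$, the $A$-numerical radius is $\omega_A(T)=\sup\{|\langle Tx\mid x\rangle_A|: x\in\mathcal{H},\ \|x\|_A=1\}$ (suprema over the empty set, occurring only if $A=0$, are $0$), and the $A$-spectral radius is $r_A(T)=\inf_{n\ge1}\|T^n\|_A^{1/n}=\lim_{n\to\infty}\|T^n\|_A^{1/n}$. *)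

theory Defs
  imports "HOL-Analysis.Analysis"
begin

text \<open>Complex Hilbert spaces. The inner product is linear in its first argument and
  antilinear in its second. The zero space is included.\<close>

class complex_hilbert_space = real_normed_vector + complete_space +
  fixes scaleC :: "complex \<Rightarrow> 'a \<Rightarrow> 'a" (infixr "*\<^sub>C" 75)
    and cinner :: "'a \<Rightarrow> 'a \<Rightarrow> complex"
  assumes scaleC_add_right: "c *\<^sub>C (x + y) = c *\<^sub>C x + c *\<^sub>C y"
    and scaleC_add_left: "(c + d) *\<^sub>C x = c *\<^sub>C x + d *\<^sub>C x"
    and scaleC_scaleC: "c *\<^sub>C (d *\<^sub>C x) = (c * d) *\<^sub>C x"
    and scaleC_of_real: "complex_of_real r *\<^sub>C x = r *\<^sub>R x"
    and cinner_commute: "cinner x y = cnj (cinner y x)"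
    and cinner_add_left: "cinner (x + y) z = cinner x z + cinner y z"
    and cinner_scaleC_left: "cinner (c *\<^sub>C x) y = c * cinner x y"
    and cinner_ge_zero: "0 \<le> Re (cinner x x)"
    and cinner_eq_zero_iff: "cinner x x = 0 \<longleftrightarrow> x = 0"
    and norm_eq_sqrt_cinner: "norm x = sqrt (Re (cinner x x))"

instantiation complex :: complex_hilbert_space
begin

definition scaleC_complex :: "complex \<Rightarrow> complex \<Rightarrow> complex"
  where "scaleC_complex c x = c * x"

definition cinner_complex :: "complex \<Rightarrow> complex \<Rightarrow> complex"
  where "cinner_complex x y = x * cnj y"

instance
  by standard
    (auto simp: scaleC_complex_def cinner_complex_def scaleR_conv_of_real algebra_simps
      cmod_def power2_eq_square)

end

definition bounded_clinear :: "('a::complex_hilbert_space \<Rightarrow> 'a) \<Rightarrow> bool"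
  where "bounded_clinear T \<longleftrightarrow> bounded_linear T \<and> (\<forall>c x. T (c *\<^sub>C x) = c *\<^sub>C T x)"

definition positive_op :: "('a::complex_hilbert_space \<Rightarrow> 'a) \<Rightarrow> bool"
  where "positive_op A \<longleftrightarrow> bounded_clinear A \<and> (\<forall>x. cinner (A x) x \<in> \<real>\<^sub>\<ge>\<^sub>0)"

definition A_inner :: "('a::complex_hilbert_space \<Rightarrow> 'a) \<Rightarrow> 'a \<Rightarrow> 'a \<Rightarrow> complex"
  where "A_inner A x y = cinner (A x) y"

definition A_seminorm :: "('a::complex_hilbert_space \<Rightarrow> 'a) \<Rightarrow> 'a \<Rightarrow> real"
  where "A_seminorm A x = sqrt (Re (A_inner A x x))"

definition A_bounded_ops :: "('a::complex_hilbert_space \<Rightarrow> 'a) \<Rightarrow> ('a \<Rightarrow> 'a) set"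
  where "A_bounded_ops A =
    {T. bounded_clinear T \<and> (\<exists>l>0. \<forall>x. A_seminorm A (T x) \<le> l * A_seminorm A x)}"

text \<open>\<open>Sup {}\<close> is unspecified for reals. The \<open>A\<close>-unit sphere is empty for \<open>A = 0\<close>, where the
  supremum is taken to be \<open>0\<close>.\<close>

definition Sup0 :: "real set \<Rightarrow> real"
  where "Sup0 X = (if X = {} then 0 else Sup X)"

definition A_opnorm :: "('a::complex_hilbert_space \<Rightarrow> 'a) \<Rightarrow> ('a \<Rightarrow> 'a) \<Rightarrow> real"
  where "A_opnorm A T = Sup0 {A_seminorm A (T x) | x. A_seminorm A x = 1}"

definition A_numerical_radius :: "('a::complex_hilbert_space \<Rightarrow> 'a) \<Rightarrow> ('a \<Rightarrow> 'a) \<Rightarrow> real"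
  where "A_numerical_radius A T = Sup0 {cmod (A_inner A (T x) x) | x. A_seminorm A x = 1}"

definition A_spectral_radius :: "('a::complex_hilbert_space \<Rightarrow> 'a) \<Rightarrow> ('a \<Rightarrow> 'a) \<Rightarrow> real"
  where "A_spectral_radius A T = (INF n\<in>{1..}. root n (A_opnorm A (T ^^ n)))"

end

theory Submission
  imports Defs
begin

text \<open>Let \<open>t > 0\<close> and factor \<open>T + S = R C\<close> through \<open>H \<times> H\<close> with
  \<open>C x = (x, S x / t)\<close> and \<open>R (x, y) = T x + t y\<close>. Then \<open>C R\<close> is the operator matrix
  with rows \<open>(T, t)\<close> and \<open>(S T / t, S)\<close>. If \<open>w\<close> exceeds the claimed bound, that is, the larger
  root of \<open>(w - \<omega>(T)) (w - \<omega>(S)) = \<parallel>S T\<parallel>\<close>, then for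
  \<open>t\<^sup>2 = (w - \<omega>(T)) (w - \<omega>(S))\<close> the numerical radius of \<open>C R\<close> is at most \<open>w\<close>.
  The case \<open>\<omega>(M\<^sup>2) \<le> \<omega>(M)\<^sup>2\<close> of the power inequality bounds the powers of \<open>C R\<close>
  with exponent \<open>n = 2 ^ k\<close> by \<open>2 w ^ n\<close>, so \<open>(T + S) ^ (n + 1) = R (C R) ^ n C\<close> has
  norm \<open>O(w ^ n)\<close>, and these exponents suffice for \<open>r(T + S) \<le> w\<close>. Exchanging \<open>T\<close> and \<open>S\<close> gives
  the bound with \<open>\<parallel>T S\<parallel>\<close>.\<close>

section \<open>Semi-inner products and the Cauchy-Schwarz inequality\<close>

text \<open>The form may be degenerate and no topology is involved, so the same results serve
  \<open>A_inner A\<close> on the Hilbert space and the sum form on its square.\<close>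

locale semi_inner_product = vector_space scale
  for scale :: "complex \<Rightarrow> 'v::ab_group_add \<Rightarrow> 'v" +
  fixes B :: "'v \<Rightarrow> 'v \<Rightarrow> complex"
  assumes B_add_left: "B (x + y) z = B x z + B y z"
    and B_scale_left: "B (scale c x) y = c * B x y"
    and B_commute: "B x y = cnj (B y x)"
    and B_nonneg: "0 \<le> Re (B x x)"
begin

lemma B_add_right: "B x (y + z) = B x y + B x z"
  by (metis B_add_left B_commute complex_cnj_add)

lemma B_scale_right: "B x (scale c y) = cnj c * B x y"
  by (metis B_scale_left B_commute complex_cnj_mult)

lemma B_minus_left: "B (- x) y = - B x y"
  using B_scale_left[of "-1" x y] by simp

lemma B_minus_right: "B x (- y) = - B x y"
  using B_scale_right[of x "-1" y] by simp

lemma B_diff_left: "B (x - y) z = B x z - B y z"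
  using B_add_left[of x "- y" z] by (simp add: B_minus_left)

lemma B_diff_right: "B x (y - z) = B x y - B x z"
  using B_add_right[of x y "- z"] by (simp add: B_minus_right)

lemmas B_simps = B_add_left B_add_right B_scale_left B_scale_right
  B_diff_left B_diff_right B_minus_left B_minus_right

definition q :: "'v \<Rightarrow> real" where "q x = Re (B x x)"

lemma q_nonneg: "0 \<le> q x"
  by (simp add: q_def B_nonneg)

lemma B_self: "B x x = of_real (q x)"
proof -
  have "Im (B x x) = 0"
    using arg_cong[OF B_commute[of x x], of Im] by simp
  then show ?thesis by (simp add: q_def complex_eq_iff)
qed

lemma q_scale: "q (scale c x) = (cmod c)\<^sup>2 * q x"
proof -
  have "B (scale c x) (scale c x) = (c * cnj c) * B x x"
    by (simp add: B_simps)
  also have "\<dots> = of_real ((cmod c)\<^sup>2 * q x)"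
    by (simp add: B_self flip: complex_norm_square)
  finally show ?thesis by (simp add: q_def)
qed

lemma q_add_le: "q (x + y) \<le> 2 * q x + 2 * q y"
proof -
  have "0 \<le> q (x - y)" by (rule q_nonneg)
  then show ?thesis by (simp add: q_def B_simps)
qed

text \<open>The factor \<open>B x y\<close> in the coefficient makes the cross term real, which
  leaves a real quadratic in \<open>s\<close> for both cases of Cauchy-Schwarz.\<close>

lemma q_diff_scale:
  "q (x - scale (of_real s * B x y) y) = q x - 2 * s * (cmod (B x y))\<^sup>2 + s\<^sup>2 * (cmod (B x y))\<^sup>2 * q y"
proof -
  let ?b = "B x y"
  have "B (x - scale (of_real s * ?b) y) (x - scale (of_real s * ?b) y) =
      B x x - 2 * of_real s * (?b * cnj ?b) + of_real (s\<^sup>2) * (?b * cnj ?b) * B y y"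
    using B_commute[of y x] by (simp add: B_simps algebra_simps power2_eq_square)
  also have "\<dots> = of_real (q x - 2 * s * (cmod ?b)\<^sup>2 + s\<^sup>2 * (cmod ?b)\<^sup>2 * q y)"
    by (simp add: B_self flip: complex_norm_square)
  finally show ?thesis by (simp add: q_def)
qed

text \<open>If \<open>q y = 0\<close>, which does not force \<open>y = 0\<close>, the quadratic in
  \<open>s\<close> is affine and nonnegative, hence constant. Otherwise it is evaluated at its
  minimum \<open>s = 1 / q y\<close> (for \<open>B x y\<close> nonzero).\<close>

lemma Cauchy_Schwarz_sq: "(cmod (B x y))\<^sup>2 \<le> q x * q y"
proof (cases "q y = 0")
  case True
  have *: "2 * s * (cmod (B x y))\<^sup>2 \<le> q x" for s
    using q_nonneg[of "x - scale (of_real s * B x y) y"] True by (simp add: q_diff_scale)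
  have "cmod (B x y) = 0"
  proof (rule ccontr)
    assume "cmod (B x y) \<noteq> 0"
    then show False
      \<comment> \<open>This \<open>s\<close> turns the left-hand side of \<open>*\<close> into
        \<open>q x + 1\<close>.\<close>
      using *[of "(q x + 1) / (2 * (cmod (B x y))\<^sup>2)"] by simp
  qed
  with True show ?thesis by simp
next
  case False
  then have pos: "0 < q y" using q_nonneg[of y] by simp
  have "0 \<le> q x - (cmod (B x y))\<^sup>2 / q y"
    using q_nonneg[of "x - scale (of_real (1 / q y) * B x y) y"] pos
    by (simp add: q_diff_scale power2_eq_square del: of_real_divide)
  then show ?thesis using pos by (simp add: field_simps)
qed

lemma Cauchy_Schwarz: "cmod (B x y) \<le> sqrt (q x) * sqrt (q y)"
  using real_le_rsqrt[OF Cauchy_Schwarz_sq[of x y]] by (simp add: real_sqrt_mult)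

section \<open>Numerical radius bounds for powers\<close>

text \<open>The bound makes the real parts of the forms of \<open>w - M\<close> and
  \<open>w + M\<close> nonnegative. Taken at \<open>y\<close> and \<open>z\<close> below, they add
  up to \<open>2 * w\<close> times the claimed difference.\<close>

lemma Re_form_square_le:
  assumes M: "module_hom scale scale M" and "0 < w"
    and bound: "\<And>x. cmod (B (M x) x) \<le> w * q x"
  shows "Re (B (M (M x)) x) \<le> w\<^sup>2 * q x"
proof -
  interpret M: module_hom scale scale M by (rule M)
  \<comment> \<open>\<open>(w - M) y = (w\<^sup>2 - M\<^sup>2) x = (w + M) z\<close> and \<open>y + z = 2 w x\<close>\<close>
  define y where "y = scale (of_real w) x + M x"
  define z where "z = scale (of_real w) x - M x"
  have y: "0 \<le> w * q y - Re (B (M y) y)"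
    using bound[of y] complex_Re_le_cmod[of "B (M y) y"] by linarith
  have z: "0 \<le> w * q z + Re (B (M z) z)"
    using bound[of z] abs_Re_le_cmod[of "B (M z) z"] by linarith
  have "(w * q y - Re (B (M y) y)) + (w * q z + Re (B (M z) z))
      = 2 * w * (w\<^sup>2 * q x - Re (B (M (M x)) x))"
    by (simp add: q_def y_def z_def M.add M.diff M.scale B_simps algebra_simps power2_eq_square)
  then have "0 \<le> 2 * w * (w\<^sup>2 * q x - Re (B (M (M x)) x))"
    using y z by linarith
  with \<open>0 < w\<close> show ?thesis by (simp add: zero_le_mult_iff)
qed

text \<open>The hypothesis is unchanged when \<open>M\<close> is multiplied by a unimodular scalar,
  so the bound on the real part upgrades to one on the modulus.\<close>

lemma form_square_le:
  assumes M: "module_hom scale scale M" and "0 < w"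
    and bound: "\<And>x. cmod (B (M x) x) \<le> w * q x"
  shows "cmod (B (M (M x)) x) \<le> w\<^sup>2 * q x"
proof (cases "B (M (M x)) x = 0")
  case True
  then show ?thesis using \<open>0 < w\<close> by (simp add: q_nonneg)
next
  case False
  interpret M: module_hom scale scale M by (rule M)
  define b where "b = B (M (M x)) x"
  \<comment> \<open>a unimodular \<open>c\<close> such that replacing \<open>M\<close> by \<open>c M\<close> makes \<open>B (M (M x)) x\<close> nonnegative\<close>
  define c where "c = csqrt (cnj b / of_real (cmod b))"
  have b: "b \<noteq> 0" using False by (simp add: b_def)
  have "c\<^sup>2 * b = (b * cnj b) / of_real (cmod b)" by (simp add: c_def)
  also have "\<dots> = of_real (cmod b)"
    using b by (simp add: power2_eq_square flip: complex_norm_square)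
  finally have c: "c\<^sup>2 * b = of_real (cmod b)" .
  have "(cmod c)\<^sup>2 = cmod (c\<^sup>2)" by (simp add: norm_power)
  also have "\<dots> = 1" using b by (simp add: c_def norm_divide)
  finally have norm_c: "cmod c = 1" using norm_ge_zero[of c] by (auto simp: power2_eq_1_iff)
  have hom: "module_hom scale scale (\<lambda>x. scale c (M x))"
    by unfold_locales (simp_all add: M.add M.scale algebra_simps)
  have "Re (B (scale c (M (scale c (M x)))) x) \<le> w\<^sup>2 * q x"
    by (rule Re_form_square_le[OF hom \<open>0 < w\<close>]) (simp add: B_simps norm_mult norm_c bound)
  moreover have "B (scale c (M (scale c (M x)))) x = of_real (cmod b)"
    unfolding c[symmetric] by (simp add: B_simps M.scale b_def power2_eq_square)
  ultimately show ?thesis by (simp only: b_def Re_complex_of_real)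
qed

lemma module_hom_funpow: "module_hom scale scale M \<Longrightarrow> module_hom scale scale (M ^^ n)"
  by (induction n) (auto simp: module_hom_iff)

text \<open>Repeated squaring: each stage applies \<open>form_square_le\<close> to
  \<open>M ^^ (2 ^ k)\<close> with \<open>w ^ (2 ^ k)\<close> in place of \<open>w\<close>.\<close>

lemma form_funpow_le:
  assumes M: "module_hom scale scale M" and "0 < w"
    and bound: "\<And>x. cmod (B (M x) x) \<le> w * q x"
  shows "cmod (B ((M ^^ (2 ^ k)) x) x) \<le> w ^ (2 ^ k) * q x"
proof (induction k arbitrary: x)
  case 0
  then show ?case using bound by simp
next
  case (Suc k)
  have "cmod (B ((M ^^ (2 ^ k)) ((M ^^ (2 ^ k)) x)) x) \<le> (w ^ (2 ^ k))\<^sup>2 * q x"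
    by (rule form_square_le[OF module_hom_funpow[OF M]]) (use \<open>0 < w\<close> Suc in auto)
  then show ?case
    by (simp add: mult_2 funpow_add power_add power2_eq_square)
qed

text \<open>The classical fact that the operator norm is at most twice the numerical radius,
  squared; it follows by polarization.\<close>

lemma q_le_of_form_le:
  assumes N: "module_hom scale scale N" and "0 < c"
    and bound: "\<And>x. cmod (B (N x) x) \<le> c * q x"
  shows "q (N x) \<le> 4 * c\<^sup>2 * q x"
proof -
  interpret N: module_hom scale scale N by (rule N)
  have pol: "Re (B (N x) y) \<le> c * (q x + q y)" for x y
  proof -
    have "2 * (Re (B (N x) y) + Re (B (N y) x)) = Re (B (N (x + y)) (x + y)) - Re (B (N (x - y)) (x - y))"
      by (simp add: N.add N.diff B_simps)
    also have "\<dots> \<le> c * q (x + y) + c * q (x - y)"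
      using bound[of "x + y"] bound[of "x - y"] abs_Re_le_cmod[of "B (N (x + y)) (x + y)"]
        abs_Re_le_cmod[of "B (N (x - y)) (x - y)"] by linarith
    also have "\<dots> = 2 * c * (q x + q y)"
      by (simp add: q_def B_simps algebra_simps)
    finally have 1: "2 * (Re (B (N x) y) + Re (B (N y) x)) \<le> 2 * c * (q x + q y)" .
    \<comment> \<open>Passing to \<open>\<i> y\<close> and imaginary parts reverses the sign of
      \<open>Re (B (N y) x)\<close>, so that adding the result to \<open>1\<close> cancels this
      term.\<close>
    let ?y = "scale \<i> y"
    have "2 * (Re (B (N x) y) - Re (B (N y) x))
        = Im (B (N (x - ?y)) (x - ?y)) - Im (B (N (x + ?y)) (x + ?y))"
      by (simp add: N.add N.diff N.scale B_simps) 
    also have "\<dots> \<le> c * q (x + ?y) + c * q (x - ?y)"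
      using bound[of "x + ?y"] bound[of "x - ?y"] abs_Im_le_cmod[of "B (N (x + ?y)) (x + ?y)"]
        abs_Im_le_cmod[of "B (N (x - ?y)) (x - ?y)"] by linarith
    also have "\<dots> = 2 * c * (q x + q y)"
      by (simp add: q_def B_simps algebra_simps)
    finally show ?thesis using 1 by simp
  qed
  \<comment> \<open>optimal scaling in \<open>pol\<close> for \<open>y = s N x\<close>\<close>
  define s where "s = 1 / (2 * c)"
  have "s * q (N x) \<le> c * (q x + s\<^sup>2 * q (N x))"
    using pol[of x "scale (of_real s) (N x)"] by (simp add: B_simps B_self q_scale)
  moreover have "c * s\<^sup>2 = s / 2" using \<open>0 < c\<close> by (simp add: s_def power2_eq_square)
  ultimately have "s * q (N x) \<le> c * q x + s / 2 * q (N x)"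
    by (metis distrib_left mult.assoc)
  then have "s * q (N x) \<le> 2 * c * q x" by simp
  then show ?thesis using \<open>0 < c\<close> by (simp add: s_def field_simps power2_eq_square)
qed

text \<open>The factor 4 does not grow with \<open>k\<close>, so it has no influence on the
  exponential growth rate.\<close>

lemma q_funpow_le:
  assumes "module_hom scale scale M" and "0 < w"
    and "\<And>x. cmod (B (M x) x) \<le> w * q x"
  shows "q ((M ^^ (2 ^ k)) x) \<le> 4 * (w ^ (2 ^ k))\<^sup>2 * q x"
  by (rule q_le_of_form_le[OF module_hom_funpow]) (use assms form_funpow_le in auto)

text \<open>This is the space on which the operator matrix \<open>C \<circ> R\<close> acts.\<close>

lemma semi_inner_product_prod:
  "semi_inner_product (\<lambda>c (x, y). (scale c x, scale c y)) (\<lambda>x y. B (fst x) (fst y) + B (snd x) (snd y))"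
  by unfold_locales
    (auto simp: B_simps algebra_simps B_nonneg intro: arg_cong2[of _ _ _ _ "(+)", OF B_commute B_commute])

end

section \<open>The semi-inner product of a positive operator\<close>

lemma vector_space_scaleC: "vector_space ((*\<^sub>C) :: complex \<Rightarrow> 'a::complex_hilbert_space \<Rightarrow> 'a)"
  by unfold_locales
    (use scaleC_of_real[of 1] in \<open>auto simp: scaleC_add_right scaleC_add_left scaleC_scaleC\<close>)

lemma bounded_clinear_module_hom:
  "bounded_clinear T \<Longrightarrow> module_hom (*\<^sub>C) (*\<^sub>C) T"
  by (simp add: bounded_clinear_def module_hom_iff vector_space_scaleC
      module_iff_vector_space linear_simps(1))

lemma cinner_add_right: "cinner x (y + z) = cinner x y + cinner (x::'a::complex_hilbert_space) z"
  by (metis cinner_add_left cinner_commute complex_cnj_add)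

lemma cinner_scaleC_right: "cinner x (c *\<^sub>C y) = cnj c * cinner x (y::'a::complex_hilbert_space)"
  by (metis cinner_scaleC_left cinner_commute complex_cnj_mult)

text \<open>Hermitian symmetry comes from the reality of the quadratic form: polarization at
  \<open>x + y\<close> compares imaginary parts, and at \<open>x + \<i> *\<^sub>C y\<close> real
  parts.\<close>

lemma semi_inner_product_A_inner:
  fixes A :: "'a::complex_hilbert_space \<Rightarrow> 'a"
  assumes "positive_op A"
  shows "semi_inner_product (*\<^sub>C) (A_inner A)"
proof -
  have A: "module_hom (*\<^sub>C) (*\<^sub>C) A"
    using assms by (simp add: positive_op_def bounded_clinear_module_hom)
  interpret A: module_hom "(*\<^sub>C)" "(*\<^sub>C)" A by (rule A)
  have nonneg: "A_inner A x x \<in> \<real>\<^sub>\<ge>\<^sub>0" for x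
    using assms by (simp add: positive_op_def A_inner_def)
  then have real: "Im (A_inner A x x) = 0" for x
    by (simp add: complex_nonneg_Reals_iff)
  have commute: "A_inner A x y = cnj (A_inner A y x)" for x y
  proof (rule complex_eqI)
    show "Im (A_inner A x y) = Im (cnj (A_inner A y x))"
      using real[of "x + y"] real[of x] real[of y]
      by (simp add: A_inner_def A.add cinner_add_left cinner_add_right)
    show "Re (A_inner A x y) = Re (cnj (A_inner A y x))"
      using real[of "x + \<i> *\<^sub>C y"] real[of x] real[of y]
      by (simp add: A_inner_def A.add A.scale cinner_add_left cinner_add_right
          cinner_scaleC_left cinner_scaleC_right)
  qed
  show ?thesis
  proof (intro semi_inner_product.intro vector_space_scaleC semi_inner_product_axioms.intro)
    show "0 \<le> Re (A_inner A x x)" for x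
      using nonneg[of x] by (simp add: complex_nonneg_Reals_iff)
  qed (fact commute | simp add: A_inner_def A.add A.scale cinner_add_left cinner_scaleC_left)+
qed

lemma Sup0_upper: "bdd_above X \<Longrightarrow> x \<in> X \<Longrightarrow> x \<le> Sup0 X"
  by (auto simp: Sup0_def intro: cSup_upper)

lemma Sup0_least: "(\<And>x. x \<in> X \<Longrightarrow> x \<le> c) \<Longrightarrow> 0 \<le> c \<Longrightarrow> Sup0 X \<le> c"
  by (auto simp: Sup0_def intro: cSup_least)

lemma Sup0_nonneg: "bdd_above X \<Longrightarrow> (\<And>x. x \<in> X \<Longrightarrow> 0 \<le> x) \<Longrightarrow> 0 \<le> Sup0 X"
  by (auto simp: Sup0_def intro: cSup_upper2)

section \<open>A-bounded operators, their seminorms and numerical radii\<close>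

locale positive_operator =
  fixes A :: "'a::complex_hilbert_space \<Rightarrow> 'a"
  assumes positive: "positive_op A"
begin

sublocale semi_inner_product "(*\<^sub>C)" "A_inner A"
  using positive by (rule semi_inner_product_A_inner)

lemma A_seminorm_eq: "A_seminorm A x = sqrt (q x)"
  by (simp add: A_seminorm_def q_def)

lemma A_seminorm_nonneg: "0 \<le> A_seminorm A x"
  by (simp add: A_seminorm_eq q_nonneg)

lemma A_seminorm_scaleC: "A_seminorm A (c *\<^sub>C x) = cmod c * A_seminorm A x"
  by (simp add: A_seminorm_eq q_scale real_sqrt_mult)

lemma A_bounded_ops_module_hom: "T \<in> A_bounded_ops A \<Longrightarrow> module_hom (*\<^sub>C) (*\<^sub>C) T"
  by (auto simp: A_bounded_ops_def intro: bounded_clinear_module_hom)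

lemma A_bounded_opsE:
  assumes "T \<in> A_bounded_ops A"
  obtains l where "0 < l" "\<And>x. A_seminorm A (T x) \<le> l * A_seminorm A x"
  using assms by (auto simp: A_bounded_ops_def)

text \<open>Squared bounds make closure under sums and composition a computation without square
  roots.\<close>

lemma A_bounded_ops_iff_q:
  "T \<in> A_bounded_ops A \<longleftrightarrow> bounded_clinear T \<and> (\<exists>l>0. \<forall>x. q (T x) \<le> l * q x)"
proof -
  have "(\<exists>l>0. \<forall>x. A_seminorm A (T x) \<le> l * A_seminorm A x) \<longleftrightarrow> (\<exists>l>0. \<forall>x. q (T x) \<le> l * q x)"
    (is "?L \<longleftrightarrow> ?R")
  proof
    assume ?L
    then obtain l where l: "0 < l" "\<And>x. A_seminorm A (T x) \<le> l * A_seminorm A x" by blast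
    have "q (T x) \<le> l\<^sup>2 * q x" for x
      using power_mono[OF l(2)[of x] A_seminorm_nonneg, of 2]
      by (simp add: A_seminorm_eq q_nonneg power_mult_distrib)
    with l(1) show ?R by (intro exI[of _ "l\<^sup>2"]) simp
  next
    assume ?R
    then obtain l where l: "0 < l" "\<And>x. q (T x) \<le> l * q x" by blast
    then show ?L
      by (intro exI[of _ "sqrt l"]) (simp add: A_seminorm_eq flip: real_sqrt_mult)
  qed
  then show ?thesis by (simp add: A_bounded_ops_def)
qed

lemma A_bounded_ops_comp:
  assumes "S \<in> A_bounded_ops A" and "T \<in> A_bounded_ops A"
  shows "S \<circ> T \<in> A_bounded_ops A"
proof -
  obtain l k where l: "0 < l" "\<And>x. q (S x) \<le> l * q x" and k: "0 < k" "\<And>x. q (T x) \<le> k * q x"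
    using assms by (auto simp: A_bounded_ops_iff_q)
  have "q (S (T x)) \<le> l * k * q x" for x
    using order_trans[OF l(2)[of "T x"] mult_left_mono[OF k(2)[of x]]] l(1) by (simp add: mult.assoc)
  with l(1) k(1) have "\<exists>m>0. \<forall>x. q ((S \<circ> T) x) \<le> m * q x"
    by (intro exI[of _ "l * k"]) simp
  moreover have "bounded_clinear (S \<circ> T)"
    using assms bounded_linear_compose[of S T]
    by (auto simp: A_bounded_ops_def bounded_clinear_def o_def)
  ultimately show ?thesis by (simp add: A_bounded_ops_iff_q)
qed

lemma A_bounded_ops_add:
  assumes "T \<in> A_bounded_ops A" and "S \<in> A_bounded_ops A"
  shows "(\<lambda>x. T x + S x) \<in> A_bounded_ops A"
proof -
  obtain l k where l: "0 < l" "\<And>x. q (T x) \<le> l * q x" and k: "0 < k" "\<And>x. q (S x) \<le> k * q x"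
    using assms by (auto simp: A_bounded_ops_iff_q)
  have "q (T x + S x) \<le> (2 * l + 2 * k) * q x" for x
    using q_add_le[of "T x" "S x"] l(2)[of x] k(2)[of x] by (simp add: algebra_simps)
  with l(1) k(1) have "\<exists>m>0. \<forall>x. q (T x + S x) \<le> m * q x"
    by (intro exI[of _ "2 * l + 2 * k"]) simp
  moreover have "bounded_clinear (\<lambda>x. T x + S x)"
    using assms
    by (auto simp: A_bounded_ops_def bounded_clinear_def scaleC_add_right intro: bounded_linear_add)
  ultimately show ?thesis by (simp add: A_bounded_ops_iff_q)
qed

lemma A_bounded_ops_id: "id \<in> A_bounded_ops A"
  unfolding A_bounded_ops_iff_q
  by (auto simp: bounded_clinear_def bounded_linear_ident id_def intro!: exI[of _ 1])

lemma A_bounded_ops_funpow: "T \<in> A_bounded_ops A \<Longrightarrow> T ^^ n \<in> A_bounded_ops A"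
  by (induction n) (auto simp: A_bounded_ops_id A_bounded_ops_comp)

text \<open>Normalization extends the bound from the unit sphere. On vectors of seminorm zero,
  A-boundedness makes both sides vanish.\<close>

lemma A_opnorm_bound:
  assumes "T \<in> A_bounded_ops A"
  shows "0 \<le> A_opnorm A T" and "A_seminorm A (T x) \<le> A_opnorm A T * A_seminorm A x"
proof -
  obtain l where l: "\<And>x. A_seminorm A (T x) \<le> l * A_seminorm A x"
    using assms by (rule A_bounded_opsE) blast
  interpret T: module_hom "(*\<^sub>C)" "(*\<^sub>C)" T
    using assms by (rule A_bounded_ops_module_hom)
  have bdd: "bdd_above {A_seminorm A (T x) | x. A_seminorm A x = 1}"
    by (rule bdd_aboveI[of _ l]) (auto, metis l mult.right_neutral)
  show "0 \<le> A_opnorm A T"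
    unfolding A_opnorm_def by (rule Sup0_nonneg[OF bdd]) (auto simp: A_seminorm_nonneg)
  show "A_seminorm A (T x) \<le> A_opnorm A T * A_seminorm A x"
  proof (cases "A_seminorm A x = 0")
    case True
    then show ?thesis using l[of x] by simp
  next
    case False
    let ?n = "A_seminorm A x"
    let ?x = "of_real (1 / ?n) *\<^sub>C x"
    have n: "0 < ?n" using False A_seminorm_nonneg[of x] by simp
    have "A_seminorm A ?x = 1"
      unfolding A_seminorm_scaleC using n by (simp add: norm_divide)
    then have "A_seminorm A (T ?x) \<le> A_opnorm A T"
      unfolding A_opnorm_def by (intro Sup0_upper[OF bdd]) auto
    then show ?thesis
      unfolding T.scale A_seminorm_scaleC using n by (simp add: norm_divide field_simps)
  qed
qed

text \<open>Cauchy-Schwarz and A-boundedness give a bound \<open>l * q x\<close>, which makes the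
  supremum finite and settles the case \<open>q x = 0\<close>.\<close>

lemma A_numerical_radius_bound:
  assumes "T \<in> A_bounded_ops A"
  shows "0 \<le> A_numerical_radius A T"
    and "cmod (A_inner A (T x) x) \<le> A_numerical_radius A T * q x"
proof -
  obtain l where l: "0 < l" "\<And>x. A_seminorm A (T x) \<le> l * A_seminorm A x"
    using assms by (rule A_bounded_opsE) blast
  interpret T: module_hom "(*\<^sub>C)" "(*\<^sub>C)" T
    using assms by (rule A_bounded_ops_module_hom)
  have le: "cmod (A_inner A (T x) x) \<le> l * q x" for x
  proof -
    have "cmod (A_inner A (T x) x) \<le> A_seminorm A (T x) * A_seminorm A x"
      unfolding A_seminorm_eq by (rule Cauchy_Schwarz)
    also have "\<dots> \<le> l * A_seminorm A x * A_seminorm A x"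
      by (intro mult_right_mono l A_seminorm_nonneg)
    finally show ?thesis by (simp add: A_seminorm_eq q_nonneg mult.assoc)
  qed
  have bdd: "bdd_above {cmod (A_inner A (T x) x) | x. A_seminorm A x = 1}"
    by (rule bdd_aboveI[of _ l])
      (auto simp: A_seminorm_eq, metis le mult.right_neutral)
  show "0 \<le> A_numerical_radius A T"
    unfolding A_numerical_radius_def by (rule Sup0_nonneg[OF bdd]) auto
  show "cmod (A_inner A (T x) x) \<le> A_numerical_radius A T * q x"
  proof (cases "q x = 0")
    case True
    then show ?thesis using le[of x] by simp
  next
    case False
    then have n: "0 < q x" using q_nonneg[of x] by simp
    let ?x = "of_real (1 / sqrt (q x)) *\<^sub>C x"
    have "A_seminorm A ?x = 1"
      unfolding A_seminorm_scaleC using n by (simp add: norm_divide A_seminorm_eq)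
    then have "cmod (A_inner A (T ?x) ?x) \<le> A_numerical_radius A T"
      unfolding A_numerical_radius_def by (intro Sup0_upper[OF bdd]) auto
    moreover have "cmod (A_inner A (T ?x) ?x) = cmod (A_inner A (T x) x) / q x"
      using n by (simp add: T.scale B_simps norm_divide norm_mult del: of_real_divide)
    ultimately have "cmod (A_inner A (T x) x) / q x \<le> A_numerical_radius A T"
      by (simp only:)
    then show ?thesis using n by (simp add: pos_divide_le_eq)
  qed
qed

end

section \<open>Powers of a factored map and two real inequalities\<close>

lemma funpow_comp_swap: "((R \<circ> C) ^^ Suc n) x = R (((C \<circ> R) ^^ n) (C x))"
  by (induction n) simp_all

text \<open>The difference of the sides is a perfect square: the off-diagonal entry is the one for
  which \<open>w\<close> is an eigenvalue of the symmetric 2 by 2 matrix.\<close>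

lemma quadratic_form_le:
  fixes a b p r w :: real
  assumes "a \<le> w" and "b \<le> w"
  shows "a * p\<^sup>2 + 2 * sqrt ((w - a) * (w - b)) * (p * r) + b * r\<^sup>2 \<le> w * (p\<^sup>2 + r\<^sup>2)"
proof -
  have "0 \<le> (sqrt (w - a) * p - sqrt (w - b) * r)\<^sup>2" by simp
  also have "\<dots> = (w - a) * p\<^sup>2 - 2 * sqrt ((w - a) * (w - b)) * (p * r) + (w - b) * r\<^sup>2"
    using assms by (simp add: power2_diff power_mult_distrib real_sqrt_mult)
  finally show ?thesis by (simp add: algebra_simps)
qed

text \<open>The lower bound on \<open>w\<close> is the larger root of
  \<open>(X - a) * (X - b) = m\<close>. The product estimate rests on \<open>(2 * w - a - b)\<^sup>2
  - (a - b)\<^sup>2 = 4 * (w - a) * (w - b)\<close>.\<close>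

lemma larger_root_less:
  fixes a b m w :: real
  assumes "0 \<le> m" and w: "1 / 2 * (a + b + sqrt ((a - b)\<^sup>2 + 4 * m)) < w"
  shows "a < w" and "b < w" and "m \<le> (w - a) * (w - b)"
proof -
  let ?d = "sqrt ((a - b)\<^sup>2 + 4 * m)"
  have d: "?d < 2 * w - a - b" using w by simp
  have "\<bar>a - b\<bar> \<le> ?d" using \<open>0 \<le> m\<close> by (intro real_le_rsqrt) simp
  with d show "a < w" "b < w" by linarith+
  have "0 \<le> ?d" using \<open>0 \<le> m\<close> by simp
  with d have "?d\<^sup>2 \<le> (2 * w - a - b)\<^sup>2" by (intro power_mono) auto
  then have "(a - b)\<^sup>2 + 4 * m \<le> (2 * w - a - b)\<^sup>2" using \<open>0 \<le> m\<close> by simp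
  then show "m \<le> (w - a) * (w - b)" by (simp add: power2_eq_square algebra_simps)
qed

section \<open>Growth of the powers of the sum\<close>

context positive_operator
begin

lemma A_seminorm_funpow_add_le:
  assumes T: "T \<in> A_bounded_ops A" and S: "S \<in> A_bounded_ops A"
    and w: "A_numerical_radius A T < w" "A_numerical_radius A S < w"
    and m: "A_opnorm A (S \<circ> T) \<le> (w - A_numerical_radius A T) * (w - A_numerical_radius A S)"
  obtains K where "0 \<le> K"
    "\<And>k x. A_seminorm A (((\<lambda>x. T x + S x) ^^ Suc (2 ^ k)) x) \<le> K * w ^ 2 ^ k * A_seminorm A x"
proof -
  let ?a = "A_numerical_radius A T" and ?b = "A_numerical_radius A S"
  define t where "t = sqrt ((w - ?a) * (w - ?b))"
  have t: "0 < t" "t\<^sup>2 = (w - ?a) * (w - ?b)" using w by (simp_all add: t_def)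
  have w0: "0 < w" using w A_numerical_radius_bound(1)[OF T] by linarith
  interpret T: module_hom "(*\<^sub>C)" "(*\<^sub>C)" T using T by (rule A_bounded_ops_module_hom)
  interpret S: module_hom "(*\<^sub>C)" "(*\<^sub>C)" S using S by (rule A_bounded_ops_module_hom)
  obtain lT lS where lT: "0 < lT" "\<And>x. q (T x) \<le> lT * q x" and lS: "0 < lS" "\<And>x. q (S x) \<le> lS * q x"
    using T S by (auto simp: A_bounded_ops_iff_q)
  \<comment> \<open>After division by \<open>t\<close>, the lower left matrix entry is bounded by
    \<open>t\<close>, just like the upper right one.\<close>
  have ST: "A_seminorm A (S (T x)) \<le> t\<^sup>2 * A_seminorm A x" for x
  proof -
    have "A_seminorm A ((S \<circ> T) x) \<le> A_opnorm A (S \<circ> T) * A_seminorm A x"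
      by (rule A_opnorm_bound(2)[OF A_bounded_ops_comp[OF S T]])
    also have "\<dots> \<le> t\<^sup>2 * A_seminorm A x"
      unfolding t(2) by (intro mult_right_mono m A_seminorm_nonneg)
    finally show ?thesis by simp
  qed
  define R where "R = (\<lambda>(x, y). T x + of_real t *\<^sub>C y)"
  define C where "C = (\<lambda>x. (x, of_real (1 / t) *\<^sub>C S x))"
  interpret P: semi_inner_product "\<lambda>c (x, y). (c *\<^sub>C x, c *\<^sub>C y)"
    "\<lambda>x y. A_inner A (fst x) (fst y) + A_inner A (snd x) (snd y)"
    by (rule semi_inner_product_prod)
  have Pq: "P.q z = q (fst z) + q (snd z)" for z
    by (simp add: P.q_def q_def)
  have t1: "of_real t * of_real (1 / t) = (1::complex)"
    using t(1) by simp
  have RC: "R \<circ> C = (\<lambda>x. T x + S x)"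
    using t1 by (simp add: fun_eq_iff R_def C_def scaleC_scaleC del: of_real_divide)
  have hom: "module_hom (\<lambda>c (x, y). (c *\<^sub>C x, c *\<^sub>C y)) (\<lambda>c (x, y). (c *\<^sub>C x, c *\<^sub>C y)) (C \<circ> R)"
    by unfold_locales
      (auto simp: R_def C_def T.add T.scale S.add S.scale scale_right_distrib scaleC_scaleC mult_ac)
  \<comment> \<open>Bounding the four matrix entries separately leaves the real quadratic form of
    \<open>quadratic_form_le\<close> in the seminorms of the components.\<close>
  have form: "cmod (A_inner A (fst ((C \<circ> R) z)) (fst z) + A_inner A (snd ((C \<circ> R) z)) (snd z))
      \<le> w * P.q z" for z
  proof -
    obtain x y where z: "z = (x, y)" by fastforce
    let ?p = "A_seminorm A x" and ?r = "A_seminorm A y"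
    have "A_inner A (fst ((C \<circ> R) z)) (fst z) + A_inner A (snd ((C \<circ> R) z)) (snd z)
        = A_inner A (T x) x + of_real t * A_inner A y x
          + of_real (1 / t) * A_inner A (S (T x)) y + A_inner A (S y) y"
      using t1 by (simp add: z R_def C_def S.add S.scale B_simps algebra_simps)
    moreover have "cmod (A_inner A (T x) x) \<le> ?a * ?p\<^sup>2"
      using A_numerical_radius_bound(2)[OF T, of x] by (simp add: A_seminorm_eq q_nonneg)
    moreover have "cmod (A_inner A (S y) y) \<le> ?b * ?r\<^sup>2"
      using A_numerical_radius_bound(2)[OF S, of y] by (simp add: A_seminorm_eq q_nonneg)
    moreover have "cmod (of_real t * A_inner A y x) \<le> t * (?p * ?r)"
      using Cauchy_Schwarz[of y x] t(1) by (simp add: norm_mult A_seminorm_eq mult_ac)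
    moreover have "cmod (of_real (1 / t) * A_inner A (S (T x)) y) \<le> t * (?p * ?r)"
    proof -
      have "cmod (A_inner A (S (T x)) y) \<le> A_seminorm A (S (T x)) * ?r"
        unfolding A_seminorm_eq by (rule Cauchy_Schwarz)
      also have "\<dots> \<le> t\<^sup>2 * ?p * ?r"
        by (intro mult_right_mono ST A_seminorm_nonneg)
      finally show ?thesis
        using t(1) by (simp add: norm_mult norm_divide field_simps power2_eq_square)
    qed
    ultimately have "cmod (A_inner A (fst ((C \<circ> R) z)) (fst z) + A_inner A (snd ((C \<circ> R) z)) (snd z))
        \<le> ?a * ?p\<^sup>2 + t * (?p * ?r) + t * (?p * ?r) + ?b * ?r\<^sup>2"
      by (smt (verit) norm_triangle_ineq)
    also have "\<dots> \<le> w * (?p\<^sup>2 + ?r\<^sup>2)"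
      using quadratic_form_le[of ?a w ?b ?p ?r] w unfolding t_def by linarith
    finally show ?thesis by (simp add: z Pq A_seminorm_eq q_nonneg)
  qed
  \<comment> \<open>\<open>KR\<close> and \<open>KC\<close> bound \<open>R\<close> and
    \<open>C\<close> for squared seminorms; the factors 2 come from \<open>q_add_le\<close>.\<close>
  define KR where "KR = 2 * lT + 2 * t\<^sup>2"
  define KC where "KC = 1 + (1 / t)\<^sup>2 * lS"
  have nonneg: "0 \<le> KR" "0 \<le> KC" using lT(1) lS(1) by (simp_all add: KR_def KC_def)
  have R_le: "q (R z) \<le> KR * P.q z" for z
  proof -
    have "q (R z) \<le> 2 * q (T (fst z)) + 2 * (t\<^sup>2 * q (snd z))"
      using q_add_le[of "T (fst z)" "of_real t *\<^sub>C snd z"]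
      by (simp add: R_def case_prod_beta q_scale)
    also have "\<dots> \<le> 2 * (lT * q (fst z)) + 2 * (t\<^sup>2 * q (snd z))"
      using lT(2) by simp
    also have "\<dots> \<le> KR * P.q z"
      using lT(1) by (simp add: KR_def Pq algebra_simps q_nonneg)
    finally show ?thesis .
  qed
  have C_le: "P.q (C x) \<le> KC * q x" for x
    using mult_left_mono[OF lS(2)[of x], of "(1 / t)\<^sup>2"]
    by (simp add: C_def Pq q_scale KC_def algebra_simps norm_divide power_divide)
  show thesis
  proof
    show "0 \<le> sqrt (KR * 4 * KC)" using nonneg by simp
    fix k x
    \<comment> \<open>Splitting off one \<open>R\<close> and one \<open>C\<close> accounts for the
      extra one in the exponent.\<close>
    have "q (((\<lambda>x. T x + S x) ^^ Suc (2 ^ k)) x) = q (R (((C \<circ> R) ^^ (2 ^ k)) (C x)))"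
      by (simp only: funpow_comp_swap flip: RC)
    also have "\<dots> \<le> KR * P.q (((C \<circ> R) ^^ (2 ^ k)) (C x))" by (rule R_le)
    also have "\<dots> \<le> KR * (4 * (w ^ 2 ^ k)\<^sup>2 * P.q (C x))"
      by (intro mult_left_mono P.q_funpow_le[OF hom w0 form] nonneg)
    also have "\<dots> \<le> KR * (4 * (w ^ 2 ^ k)\<^sup>2 * (KC * q x))"
      by (intro mult_left_mono C_le nonneg) simp
    also have "\<dots> = (KR * 4 * KC) * (w ^ 2 ^ k)\<^sup>2 * q x" by simp
    finally have "sqrt (q (((\<lambda>x. T x + S x) ^^ Suc (2 ^ k)) x))
        \<le> sqrt ((KR * 4 * KC) * (w ^ 2 ^ k)\<^sup>2 * q x)"
      by (rule real_sqrt_le_mono)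
    also have "\<dots> = sqrt (KR * 4 * KC) * w ^ 2 ^ k * sqrt (q x)"
      using w0 by (simp only: real_sqrt_mult real_sqrt_abs) simp
    finally show "A_seminorm A (((\<lambda>x. T x + S x) ^^ Suc (2 ^ k)) x)
        \<le> sqrt (KR * 4 * KC) * w ^ 2 ^ k * A_seminorm A x"
      by (simp only: A_seminorm_eq)
  qed
qed

section \<open>From growth of powers to the spectral radius\<close>

text \<open>The spectral radius is an infimum, so the exponents \<open>Suc (2 ^ k)\<close> suffice:
  a value above \<open>w\<close> would force \<open>(?r / w) ^ 2 ^ k\<close> to stay
  bounded.\<close>

lemma A_spectral_radius_le:
  assumes U: "U \<in> A_bounded_ops A"
    and "0 < w" "0 \<le> K"
    and K: "\<And>k x. A_seminorm A ((U ^^ Suc (2 ^ k)) x) \<le> K * w ^ 2 ^ k * A_seminorm A x"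
  shows "A_spectral_radius A U \<le> w"
proof (rule ccontr)
  let ?r = "A_spectral_radius A U"
  assume "\<not> ?r \<le> w"
  then have r: "w < ?r" by simp
  have "0 \<le> A_opnorm A (U ^^ n)" for n
    by (rule A_opnorm_bound(1)[OF A_bounded_ops_funpow[OF U]])
  then have bdd: "bdd_below ((\<lambda>n. root n (A_opnorm A (U ^^ n))) ` {1..})"
    by (intro bdd_belowI[of _ 0]) (auto intro: real_root_ge_zero)
  have bound: "?r * (?r / w) ^ 2 ^ k \<le> K" for k
  proof -
    let ?n = "Suc (2 ^ k)"
    have "?r \<le> root ?n (A_opnorm A (U ^^ ?n))"
      unfolding A_spectral_radius_def by (rule cINF_lower[OF bdd]) simp
    then have "?r ^ ?n \<le> root ?n (A_opnorm A (U ^^ ?n)) ^ ?n"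
      using r \<open>0 < w\<close> by (intro power_mono) auto
    also have "\<dots> = A_opnorm A (U ^^ ?n)"
      using \<open>0 \<le> A_opnorm A (U ^^ ?n)\<close> by (intro real_root_pow_pos2) auto
    also have "\<dots> \<le> K * w ^ 2 ^ k"
      unfolding A_opnorm_def
    \<comment> \<open>The bound must also be nonnegative, to cover the value 0 on an empty unit
      sphere.\<close>
    proof (rule Sup0_least)
      fix v assume "v \<in> {A_seminorm A ((U ^^ ?n) x) |x. A_seminorm A x = 1}"
      then obtain x where "v = A_seminorm A ((U ^^ ?n) x)" "A_seminorm A x = 1" by blast
      then show "v \<le> K * w ^ 2 ^ k" using K[of k x] by simp
    qed (use \<open>0 \<le> K\<close> \<open>0 < w\<close> in simp)
    finally show ?thesis using \<open>0 < w\<close> by (simp add: power_divide field_simps)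
  qed
  obtain k where "K / ?r < (?r / w) ^ k"
    using real_arch_pow[of "?r / w" "K / ?r"] r \<open>0 < w\<close> by auto
  also have "\<dots> \<le> (?r / w) ^ 2 ^ k"
    using r \<open>0 < w\<close> by (intro power_increasing) (auto simp: less_imp_le)
  finally have "K < ?r * (?r / w) ^ 2 ^ k"
    using r \<open>0 < w\<close> by (simp add: field_simps)
  with bound[of k] show False by simp
qed

lemma A_spectral_radius_add_le:
  assumes T: "T \<in> A_bounded_ops A" and S: "S \<in> A_bounded_ops A"
  shows "A_spectral_radius A (\<lambda>x. T x + S x) \<le>
    1 / 2 * (A_numerical_radius A T + A_numerical_radius A S +
      sqrt ((A_numerical_radius A T - A_numerical_radius A S)\<^sup>2 + 4 * A_opnorm A (S \<circ> T)))"
\<comment> \<open>Taking \<open>w\<close> strictly above the bound makes both factors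
  \<open>w - \<omega>\<close> positive, hence \<open>t > 0\<close>, as the division by
  \<open>t\<close> requires.\<close>
proof (rule dense_ge)
  fix w
  assume w: "1 / 2 * (A_numerical_radius A T + A_numerical_radius A S +
      sqrt ((A_numerical_radius A T - A_numerical_radius A S)\<^sup>2 + 4 * A_opnorm A (S \<circ> T))) < w"
  have "0 \<le> A_opnorm A (S \<circ> T)"
    by (rule A_opnorm_bound(1)[OF A_bounded_ops_comp[OF S T]])
  note root = larger_root_less[OF this w]
  obtain K where K: "0 \<le> K"
    "\<And>k x. A_seminorm A (((\<lambda>x. T x + S x) ^^ Suc (2 ^ k)) x) \<le> K * w ^ 2 ^ k * A_seminorm A x"
    using A_seminorm_funpow_add_le[OF T S root] by blast
  have w0: "0 < w" using root(1) A_numerical_radius_bound(1)[OF T] by linarith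
  show "A_spectral_radius A (\<lambda>x. T x + S x) \<le> w"
    by (rule A_spectral_radius_le[OF A_bounded_ops_add[OF T S] w0 K])
qed

end

theorem corollary2p3:
  fixes A T S :: "'a::complex_hilbert_space \<Rightarrow> 'a"
  assumes "positive_op A"
    and "T \<in> A_bounded_ops A" and "S \<in> A_bounded_ops A"
  shows "A_spectral_radius A (\<lambda>x. T x + S x) \<le>
    1 / 2 * (A_numerical_radius A T + A_numerical_radius A S +
      sqrt ((A_numerical_radius A T - A_numerical_radius A S)\<^sup>2 +
        4 * min (A_opnorm A (T \<circ> S)) (A_opnorm A (S \<circ> T))))"
proof -
  interpret positive_operator A by unfold_locales (rule assms)
  \<comment> \<open>Exchanging \<open>T\<close> and \<open>S\<close> changes only the product under
    the root, so the two bounds combine to the minimum.\<close>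
  show ?thesis
    using A_spectral_radius_add_le[OF assms(2,3)] A_spectral_radius_add_le[OF assms(3,2)]
    by (simp add: min_def add.commute power2_commute)
qed

end
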